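(* The diagonal map preserves the row index: let $\lambda$ be a positive integer with $\gcd(\lambda,6)=1$, and let $n=\lambda\cdot 2^a\cdot 3^b-1$ be at position $(a,b)$ of $\mathcal{L}_\lambda$ with $a\ge 2$, $b\ge 0$ and $a+b=k$. Then the next odd number in the Collatz trajectory of $n$ is at position $(a-1,b+1)$ of $\mathcal{L}_\lambda$, with $(a-1)+(b+1)=k$.
   Context: The Collatz map is $C(n)=n/2$ if $n$ is even and $C(n)=3n+1$ if $n$ is odd; the trajectory of $n$ is $n,C(n),C(C(n)),\dots$, and the next odd number is the first odd term after $n$ itself. For a positive integer $\lambda$ coprime to $6$, the odd skeleton is $\mathcal{L}_\lambda=\{\lambda\cdot 2^a\cdot 3^b-1: a\ge 1,\ b\ge 0\}$; the element $\lambda\cdot 2^a\cdot 3^b-1$ is at position $(a,b)$, and its row index is $a+b$. The diagonal map, defined at positions with $a\ge 2$, sends position $(a,b)$ to the position of the next odd number in the Collatz trajectory. *)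

theory Defs
  imports Main
begin

definition collatz :: "nat \<Rightarrow> nat" where
  "collatz n = (if even n then n div 2 else 3 * n + 1)"

text \<open>
  A relation rather than a function, so that asserting it includes the claim that an odd term
  occurs in the trajectory after its starting point.
\<close>
definition is_next_odd :: "nat \<Rightarrow> nat \<Rightarrow> bool" where
  "is_next_odd n m \<longleftrightarrow>
     (\<exists>i\<ge>1. (collatz ^^ i) n = m \<and> odd m \<and> (\<forall>j. 1 \<le> j \<and> j < i \<longrightarrow> even ((collatz ^^ j) n)))"

text \<open>
  The subtraction does not truncate for positive \<open>l\<close>. Throughout, \<open>l\<close> is the parameter
  \<open>\<lambda>\<close>, assumed positive and coprime to 6 wherever these notions are used.
\<close>
definition skeleton_elem :: "nat \<Rightarrow> nat \<times> nat \<Rightarrow> nat" where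
  "skeleton_elem l = (\<lambda>(a, b). l * 2 ^ a * 3 ^ b - 1)"

definition positions :: "(nat \<times> nat) set" where
  "positions = {(a, b). a \<ge> 1}"

definition odd_skeleton :: "nat \<Rightarrow> nat set" where
  "odd_skeleton l = skeleton_elem l ` positions"

definition at_position :: "nat \<Rightarrow> nat \<Rightarrow> nat \<times> nat \<Rightarrow> bool" where
  "at_position l n p \<longleftrightarrow> p \<in> positions \<and> n = skeleton_elem l p"

definition row_index :: "nat \<times> nat \<Rightarrow> nat" where
  "row_index = (\<lambda>(a, b). a + b)"

text \<open>
  Meaningful only at positions \<open>(a, b)\<close> with \<open>a \<ge> 2\<close>, the domain of the diagonal map.
\<close>
definition diagonal_map :: "nat \<Rightarrow> nat \<times> nat \<Rightarrow> nat \<times> nat" where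
  "diagonal_map l p = (THE q. \<exists>m. is_next_odd (skeleton_elem l p) m \<and> at_position l m q)"

end

theory Submission
  imports Defs
begin

text \<open>
  If \<open>n + 1 = 4 t\<close> with \<open>t > 0\<close>, then \<open>n\<close> is odd, its image \<open>3 n + 1 = 2 (6 t - 1)\<close> is even, and
  halving gives the odd number \<open>6 t - 1\<close>. Hence one odd-to-odd step multiplies \<open>n + 1\<close> by
  \<open>3 / 2\<close>; applied to \<open>n + 1 = \<lambda> 2\<^sup>a 3\<^sup>b\<close> with \<open>a \<ge> 2\<close>, it trades one factor 2 for one factor 3, so
  the total number \<open>a + b\<close> of such factors is unchanged (\<open>is_next_odd_skeleton_elem\<close>).

  The diagonal map is given by a definite description, so its value also requires uniqueness: a
  number has at most one next odd number (\<open>is_next_odd_unique\<close>), and a skeleton element determines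
  its position by unique factorization (\<open>inj_skeleton_elem\<close>).
\<close>

lemma is_next_odd_unique:
  assumes "is_next_odd n m" and "is_next_odd n m'"
  shows "m = m'"
proof -
  from assms(1) obtain i where i: "i \<ge> 1" "(collatz ^^ i) n = m" "odd m"
      "\<forall>j. 1 \<le> j \<and> j < i \<longrightarrow> even ((collatz ^^ j) n)"
    unfolding is_next_odd_def by blast
  from assms(2) obtain i' where i': "i' \<ge> 1" "(collatz ^^ i') n = m'" "odd m'"
      "\<forall>j. 1 \<le> j \<and> j < i' \<longrightarrow> even ((collatz ^^ j) n)"
    unfolding is_next_odd_def by blast
  have "\<not> i < i'" "\<not> i' < i"
    using i i' by blast+
  then have "i = i'"
    by simp
  with i i' show ?thesis
    by simp
qed

lemma two_power_mult_odd_le: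
  fixes u v :: nat
  assumes "2 ^ a * u = 2 ^ c * v" and "odd u"
  shows "c \<le> a"
proof (rule ccontr)
  assume "\<not> c \<le> a"
  then obtain d where "c = a + Suc d"
    using less_iff_Suc_add by (metis add_Suc_right not_le)
  with assms(1) have "u = 2 * (2 ^ d * v)"
    by (simp add: power_add)
  with assms(2) show False
    by simp
qed

lemma inj_skeleton_elem:
  assumes "l > 0"
  shows "inj (skeleton_elem l)"
proof (rule injI)
  fix p q :: "nat \<times> nat"
  assume eq: "skeleton_elem l p = skeleton_elem l q"
  obtain a b c d where pq: "p = (a, b)" "q = (c, d)"
    by (cases p, cases q)
  \<comment> \<open>Both products are positive, so the truncated subtraction of 1 can be undone.\<close>
  have "l * 2 ^ a * 3 ^ b > 0" "l * 2 ^ c * 3 ^ d > 0"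
    using assms by simp_all
  moreover have "l * 2 ^ a * 3 ^ b - 1 = l * 2 ^ c * 3 ^ d - 1"
    using eq pq by (simp add: skeleton_elem_def)
  ultimately have "l * 2 ^ a * 3 ^ b = l * 2 ^ c * 3 ^ d"
    by linarith
  then have *: "(2 :: nat) ^ a * 3 ^ b = 2 ^ c * 3 ^ d"
    using assms by (simp add: mult.assoc)
  then have "a = c"
    using two_power_mult_odd_le[OF *] two_power_mult_odd_le[OF *[symmetric]] by simp
  with * pq show "p = q"
    by simp
qed

lemma is_next_odd_4_mult_minus_1:
  assumes "t > 0"
  shows "is_next_odd (4 * t - 1) (6 * t - 1)"
proof -
  have up: "collatz (4 * t - 1) = 2 * (6 * t - 1)"
    using assms by (simp add: collatz_def)
  have down: "collatz (2 * (6 * t - 1)) = 6 * t - 1"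
    by (simp add: collatz_def)
  have "(collatz ^^ 2) (4 * t - 1) = collatz (collatz (4 * t - 1))"
    by (simp add: eval_nat_numeral)
  then have "(collatz ^^ 2) (4 * t - 1) = 6 * t - 1"
    by (simp only: up down)
  moreover have "odd (6 * t - 1)"
    using assms by simp
  moreover have "even ((collatz ^^ j) (4 * t - 1))" if "1 \<le> j \<and> j < 2" for j
  proof -
    from that have "j = 1"
      by simp
    then show ?thesis
      using up by simp
  qed
  ultimately show ?thesis
    unfolding is_next_odd_def by (intro exI[of _ 2]) simp
qed

text \<open>
  At a position with \<open>a \<ge> 2\<close> the number 4 divides \<open>n + 1\<close>, so a single halving after the step
  \<open>n \<mapsto> 3 n + 1\<close> already reaches an odd number.
\<close>
lemma is_next_odd_skeleton_elem:
  assumes "l > 0" and "a \<ge> 2"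
  shows "is_next_odd (skeleton_elem l (a, b)) (skeleton_elem l (a - 1, b + 1))"
proof -
  obtain c where a: "a = Suc (Suc c)"
    using \<open>a \<ge> 2\<close> by (metis One_nat_def Suc_le_D Suc_le_mono numeral_2_eq_2)
  let ?t = "l * 2 ^ c * 3 ^ b"
  have "skeleton_elem l (a, b) = 4 * ?t - 1" "skeleton_elem l (a - 1, b + 1) = 6 * ?t - 1"
    by (simp_all add: skeleton_elem_def a)
  then show ?thesis
    using is_next_odd_4_mult_minus_1[of ?t] \<open>l > 0\<close> by simp
qed

lemma diagonal_map_eq:
  assumes "l > 0" and "a \<ge> 2"
  shows "diagonal_map l (a, b) = (a - 1, b + 1)"
  unfolding diagonal_map_def
proof (rule the_equality)
  show "\<exists>m. is_next_odd (skeleton_elem l (a, b)) m \<and> at_position l m (a - 1, b + 1)"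
    using is_next_odd_skeleton_elem[OF assms] \<open>a \<ge> 2\<close>
    by (auto simp: at_position_def positions_def)
next
  fix q
  assume "\<exists>m. is_next_odd (skeleton_elem l (a, b)) m \<and> at_position l m q"
  then have "is_next_odd (skeleton_elem l (a, b)) (skeleton_elem l q)"
    by (auto simp: at_position_def)
  then have "skeleton_elem l q = skeleton_elem l (a - 1, b + 1)"
    using is_next_odd_unique is_next_odd_skeleton_elem[OF assms] by blast
  then show "q = (a - 1, b + 1)"
    using inj_skeleton_elem[OF \<open>l > 0\<close>] by (simp add: inj_eq)
qed

theorem corollary3p8:
  fixes l a b k n :: nat
  assumes "l > 0" and "gcd l 6 = 1"
    and "at_position l n (a, b)" and "a \<ge> 2" and "a + b = k"
  shows "(\<exists>m. is_next_odd n m \<and> m \<in> odd_skeleton l \<and> at_position l m (a - 1, b + 1))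
    \<and> diagonal_map l (a, b) = (a - 1, b + 1)
    \<and> (a - 1) + (b + 1) = k
    \<and> row_index (diagonal_map l (a, b)) = row_index (a, b)"
proof -
  let ?m = "skeleton_elem l (a - 1, b + 1)"
  have "is_next_odd n ?m"
    using is_next_odd_skeleton_elem[OF assms(1,4)] assms(3) by (simp add: at_position_def)
  moreover have "(a - 1, b + 1) \<in> positions"
    using assms(4) by (simp add: positions_def)
  ultimately have "\<exists>m. is_next_odd n m \<and> m \<in> odd_skeleton l \<and> at_position l m (a - 1, b + 1)"
    unfolding odd_skeleton_def at_position_def by blast
  then show ?thesis
    using diagonal_map_eq[OF assms(1,4)] assms(4,5) by (simp add: row_index_def)
qed

end
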